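(* Let $\lambda$ be an ordinal greater than the first infinite ordinal $\omega$, and let $I$ be the set of ordinals less than $\lambda$. Set $\Gamma=I\times I$. (1) If $A$ is a left artinian unital ring, then $\mathrm{UT}_I(A)$ is a left $\Gamma_0$-artinian ring that is not left $\Gamma_0$-noetherian. (2) If $A$ is a right artinian unital ring, then $\mathrm{UT}_{I^{op}}(A)$ is a right $\Gamma_0$-artinian ring that is not right $\Gamma_0$-noetherian.
   Context: For a set $I$, $I\times I$ is a groupoid: $(z,w)(y,x)$ is defined iff $w=y$, and then $(z,y)(y,x)=(z,x)$; its set of objects (identified with identities) is $\Gamma_0=\{(i,i):i\in I\}$; for $\gamma=(i,j)$, $r(\gamma)=(i,i)$ and $d(\gamma)=(j,j)$. For a unital ring $A$ and a partially ordered set $I$, $\mathrm{UT}_I(A)$ is the ring of $I\times I$ matrices $(a_{ij})$ over $A$ with only finitely many nonzero entries and with $a_{ij}=0$ whenever $i\not\leq j$. It is $I\times I$-graded by $\mathrm{UT}_I(A)_{(i,j)}=AE_{ij}$ if $i\le j$ and $0$ otherwise, where $E_{ij}$ is the elementary matrix with $1$ in entry $(i,j)$ and $0$ elsewhere; the identity of the component of degree $(i,i)$ is $E_{ii}$. The set of ordinals less than $\lambda$ carries its usual order, and $I^{op}$ is the set $I$ with the reversed order. For a $\Gamma$-graded ring $R=\bigoplus_{\gamma}R_\gamma$ with identities $1_e\in R_e$ ($e\in\Gamma_0$), a graded (one-sided) submodule is one that is the direct sum of its intersections with the homogeneous components. $R$ is right $\Gamma_0$-artinian (resp. right $\Gamma_0$-noetherian)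 if for every $e\in\Gamma_0$ the right $R$-module $1_eR=\bigoplus_{r(\gamma)=e}R_\gamma$ satisfies the descending (resp. ascending) chain condition on graded submodules. $R$ is left $\Gamma_0$-artinian (resp. left $\Gamma_0$-noetherian) if for every $e\in\Gamma_0$ the left $R$-module $R1_e=\bigoplus_{d(\gamma)=e}R_\gamma$ satisfies the descending (resp. ascending) chain condition on graded submodules.
   Formalization: The unital ring A is assumed to be nonzero; for A = 0 the ring UT_I(A) is zero, hence Γ_0-noetherian, and the claim fails. *)

theory Defs
  imports "HOL-Algebra.AbelCoset"
begin

unbundle cardinal_syntax

section \<open>Groupoids\<close>

text \<open>Objects are identified with identity arrows; \<open>gcomp G g h\<close> is the composite \<open>g h\<close>,
  which is meaningful only if \<open>gdom G g = gran G h\<close>.\<close>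

record 'g groupoid =
  arrows :: "'g set"
  gdom :: "'g \<Rightarrow> 'g"
  gran :: "'g \<Rightarrow> 'g"
  gcomp :: "'g \<Rightarrow> 'g \<Rightarrow> 'g"

definition objects :: "('g, 'n) groupoid_scheme \<Rightarrow> 'g set" where
  "objects G = {e \<in> arrows G. gdom G e = e}"

locale groupoid =
  fixes G :: "('g, 'n) groupoid_scheme"
  assumes gdom_object: "g \<in> arrows G \<Longrightarrow> gdom G g \<in> objects G"
    and gran_object: "g \<in> arrows G \<Longrightarrow> gran G g \<in> objects G"
    and gran_id: "e \<in> objects G \<Longrightarrow> gran G e = e"
    and gcomp_closed: "\<lbrakk>g \<in> arrows G; h \<in> arrows G; gdom G g = gran G h\<rbrakk> \<Longrightarrow> gcomp G g h \<in> arrows G"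
    and gdom_gcomp: "\<lbrakk>g \<in> arrows G; h \<in> arrows G; gdom G g = gran G h\<rbrakk> \<Longrightarrow> gdom G (gcomp G g h) = gdom G h"
    and gran_gcomp: "\<lbrakk>g \<in> arrows G; h \<in> arrows G; gdom G g = gran G h\<rbrakk> \<Longrightarrow> gran G (gcomp G g h) = gran G g"
    and gcomp_assoc:
      "\<lbrakk>g \<in> arrows G; h \<in> arrows G; k \<in> arrows G; gdom G g = gran G h; gdom G h = gran G k\<rbrakk>
        \<Longrightarrow> gcomp G (gcomp G g h) k = gcomp G g (gcomp G h k)"
    and gcomp_gdom: "g \<in> arrows G \<Longrightarrow> gcomp G g (gdom G g) = g"
    and gcomp_gran: "g \<in> arrows G \<Longrightarrow> gcomp G (gran G g) g = g"
    and ginverse: "g \<in> arrows G \<Longrightarrow>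
      \<exists>h \<in> arrows G. gdom G h = gran G g \<and> gran G h = gdom G g \<and>
        gcomp G h g = gdom G g \<and> gcomp G g h = gran G g"

definition pair_groupoid :: "'i set \<Rightarrow> ('i \<times> 'i) groupoid" where
  "pair_groupoid I =
     \<lparr>arrows = I \<times> I,
      gdom = (\<lambda>(i, j). (j, j)),
      gran = (\<lambda>(i, j). (i, i)),
      gcomp = (\<lambda>(z, w) (y, x). (z, x))\<rparr>"


section \<open>Graded rings\<close>

text \<open>Rings without the requirement of an identity; the field \<^term>\<open>one R\<close> of the record is
  not constrained.\<close>

locale rng = abelian_group R for R (structure) +
  assumes mult_closed: "\<lbrakk>x \<in> carrier R; y \<in> carrier R\<rbrakk> \<Longrightarrow> x \<otimes> y \<in> carrier R"
    and mult_assoc: "\<lbrakk>x \<in> carrier R; y \<in> carrier R; z \<in> carrier R\<rbrakk>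
      \<Longrightarrow> (x \<otimes> y) \<otimes> z = x \<otimes> (y \<otimes> z)"
    and distrib_right: "\<lbrakk>x \<in> carrier R; y \<in> carrier R; z \<in> carrier R\<rbrakk>
      \<Longrightarrow> (x \<oplus> y) \<otimes> z = x \<otimes> z \<oplus> y \<otimes> z"
    and distrib_left: "\<lbrakk>x \<in> carrier R; y \<in> carrier R; z \<in> carrier R\<rbrakk>
      \<Longrightarrow> z \<otimes> (x \<oplus> y) = z \<otimes> x \<oplus> z \<otimes> y"

text \<open>\<open>M\<close> is the internal direct sum of the additive subgroups \<open>H g\<close>, \<open>g \<in> S\<close>: the summation map
  from the finitely supported families onto \<open>M\<close> is bijective.\<close>

definition internal_direct_sum ::
    "('b, 'm) ring_scheme \<Rightarrow> 'g set \<Rightarrow> ('g \<Rightarrow> 'b set) \<Rightarrow> 'b set \<Rightarrow> bool" where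
  "internal_direct_sum R S H M \<longleftrightarrow>
     (\<forall>g\<in>S. additive_subgroup (H g) R) \<and>
     bij_betw (\<lambda>f. \<Oplus>\<^bsub>R\<^esub>g\<in>{g \<in> S. f g \<noteq> \<zero>\<^bsub>R\<^esub>}. f g)
       {f \<in> (\<Pi>\<^sub>E g\<in>S. H g). finite {g \<in> S. f g \<noteq> \<zero>\<^bsub>R\<^esub>}} M"

text \<open>\<open>C g\<close> is the homogeneous component of degree \<open>g\<close>, and \<open>u e\<close> is the identity of the
  component of degree \<open>e\<close>.\<close>

locale groupoid_graded_ring = groupoid G + rng R
  for G :: "('g, 'n) groupoid_scheme" and R :: "('b, 'm) ring_scheme" (structure) +
  fixes C :: "'g \<Rightarrow> 'b set" and u :: "'g \<Rightarrow> 'b"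
  assumes direct_sum: "internal_direct_sum R (arrows G) C (carrier R)"
    and mult_comp: "\<lbrakk>g \<in> arrows G; h \<in> arrows G; gdom G g = gran G h; x \<in> C g; y \<in> C h\<rbrakk>
      \<Longrightarrow> x \<otimes> y \<in> C (gcomp G g h)"
    and mult_not_comp: "\<lbrakk>g \<in> arrows G; h \<in> arrows G; gdom G g \<noteq> gran G h; x \<in> C g; y \<in> C h\<rbrakk>
      \<Longrightarrow> x \<otimes> y = \<zero>"
    and id_mem: "e \<in> objects G \<Longrightarrow> u e \<in> C e"
    and id_left: "\<lbrakk>g \<in> arrows G; x \<in> C g\<rbrakk> \<Longrightarrow> u (gran G g) \<otimes> x = x"
    and id_right: "\<lbrakk>g \<in> arrows G; x \<in> C g\<rbrakk> \<Longrightarrow> x \<otimes> u (gdom G g) = x"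


section \<open>Chain conditions\<close>

definition dcc :: "'b set set \<Rightarrow> bool" where
  "dcc \<S> \<longleftrightarrow>
     (\<forall>f :: nat \<Rightarrow> 'b set. range f \<subseteq> \<S> \<and> antimono f \<longrightarrow> (\<exists>m. \<forall>n\<ge>m. f n = f m))"

definition acc :: "'b set set \<Rightarrow> bool" where
  "acc \<S> \<longleftrightarrow>
     (\<forall>f :: nat \<Rightarrow> 'b set. range f \<subseteq> \<S> \<and> mono f \<longrightarrow> (\<exists>m. \<forall>n\<ge>m. f n = f m))"

definition left_submodule :: "('b, 'm) ring_scheme \<Rightarrow> 'b set \<Rightarrow> bool" where
  "left_submodule R N \<longleftrightarrow>
     additive_subgroup N R \<and> (\<forall>a\<in>carrier R. \<forall>x\<in>N. a \<otimes>\<^bsub>R\<^esub> x \<in> N)"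

definition right_submodule :: "('b, 'm) ring_scheme \<Rightarrow> 'b set \<Rightarrow> bool" where
  "right_submodule R N \<longleftrightarrow>
     additive_subgroup N R \<and> (\<forall>a\<in>carrier R. \<forall>x\<in>N. x \<otimes>\<^bsub>R\<^esub> a \<in> N)"

definition left_artinian :: "('b, 'm) ring_scheme \<Rightarrow> bool" where
  "left_artinian R \<longleftrightarrow> dcc {N. left_submodule R N}"

definition right_artinian :: "('b, 'm) ring_scheme \<Rightarrow> bool" where
  "right_artinian R \<longleftrightarrow> dcc {N. right_submodule R N}"

definition is_graded ::
    "('g, 'n) groupoid_scheme \<Rightarrow> ('b, 'm) ring_scheme \<Rightarrow> ('g \<Rightarrow> 'b set) \<Rightarrow> 'b set \<Rightarrow> bool" where
  "is_graded G R C N \<longleftrightarrow> internal_direct_sum R (arrows G) (\<lambda>g. N \<inter> C g) N"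

text \<open>The graded submodules of the left module \<open>R 1\<^sub>e\<close> and of the right module \<open>1\<^sub>e R\<close>.\<close>

definition graded_left_submodules ::
    "('g, 'n) groupoid_scheme \<Rightarrow> ('b, 'm) ring_scheme \<Rightarrow> ('g \<Rightarrow> 'b set) \<Rightarrow> ('g \<Rightarrow> 'b) \<Rightarrow>
      'g \<Rightarrow> 'b set set" where
  "graded_left_submodules G R C u e =
     {N. N \<subseteq> (\<lambda>x. x \<otimes>\<^bsub>R\<^esub> u e) ` carrier R \<and> left_submodule R N \<and> is_graded G R C N}"

definition graded_right_submodules ::
    "('g, 'n) groupoid_scheme \<Rightarrow> ('b, 'm) ring_scheme \<Rightarrow> ('g \<Rightarrow> 'b set) \<Rightarrow> ('g \<Rightarrow> 'b) \<Rightarrow>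
      'g \<Rightarrow> 'b set set" where
  "graded_right_submodules G R C u e =
     {N. N \<subseteq> (\<lambda>x. u e \<otimes>\<^bsub>R\<^esub> x) ` carrier R \<and> right_submodule R N \<and> is_graded G R C N}"

definition left_Gamma0_artinian ::
    "('g, 'n) groupoid_scheme \<Rightarrow> ('b, 'm) ring_scheme \<Rightarrow> ('g \<Rightarrow> 'b set) \<Rightarrow> ('g \<Rightarrow> 'b) \<Rightarrow> bool" where
  "left_Gamma0_artinian G R C u \<longleftrightarrow> (\<forall>e\<in>objects G. dcc (graded_left_submodules G R C u e))"

definition left_Gamma0_noetherian ::
    "('g, 'n) groupoid_scheme \<Rightarrow> ('b, 'm) ring_scheme \<Rightarrow> ('g \<Rightarrow> 'b set) \<Rightarrow> ('g \<Rightarrow> 'b) \<Rightarrow> bool" where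
  "left_Gamma0_noetherian G R C u \<longleftrightarrow> (\<forall>e\<in>objects G. acc (graded_left_submodules G R C u e))"

definition right_Gamma0_artinian ::
    "('g, 'n) groupoid_scheme \<Rightarrow> ('b, 'm) ring_scheme \<Rightarrow> ('g \<Rightarrow> 'b set) \<Rightarrow> ('g \<Rightarrow> 'b) \<Rightarrow> bool" where
  "right_Gamma0_artinian G R C u \<longleftrightarrow> (\<forall>e\<in>objects G. dcc (graded_right_submodules G R C u e))"

definition right_Gamma0_noetherian ::
    "('g, 'n) groupoid_scheme \<Rightarrow> ('b, 'm) ring_scheme \<Rightarrow> ('g \<Rightarrow> 'b set) \<Rightarrow> ('g \<Rightarrow> 'b) \<Rightarrow> bool" where
  "right_Gamma0_noetherian G R C u \<longleftrightarrow> (\<forall>e\<in>objects G. acc (graded_right_submodules G R C u e))"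


section \<open>Upper triangular matrices\<close>

text \<open>A partially ordered set is given by its order relation \<open>r\<close>, with underlying set
  \<^term>\<open>Field r\<close>, so that \<open>i \<le> j\<close> is \<open>(i, j) \<in> r\<close> and the reversed order is \<open>r\<inverse>\<close>. A matrix indexed
  by \<open>Field r\<close> is extended by zero to the whole index type; since \<open>r \<subseteq> Field r \<times> Field r\<close>, the
  support condition below also expresses this. The sum in the product is restricted to its nonzero
  terms because \<^term>\<open>finsum\<close> over an infinite set is a default value. The identity matrix lies in
  the carrier only if \<open>Field r\<close> is finite.\<close>

definition UT :: "'i rel \<Rightarrow> ('a, 'm) ring_scheme \<Rightarrow> ('i \<Rightarrow> 'i \<Rightarrow> 'a) ring" where
  "UT r A =
     \<lparr>carrier = {a. (\<forall>i j. a i j \<in> carrier A) \<and>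
                    finite {(i, j). a i j \<noteq> \<zero>\<^bsub>A\<^esub>} \<and>
                    (\<forall>i j. (i, j) \<notin> r \<longrightarrow> a i j = \<zero>\<^bsub>A\<^esub>)},
      monoid.mult = (\<lambda>a b i j.
        \<Oplus>\<^bsub>A\<^esub>k\<in>{k. a i k \<otimes>\<^bsub>A\<^esub> b k j \<noteq> \<zero>\<^bsub>A\<^esub>}. a i k \<otimes>\<^bsub>A\<^esub> b k j),
      one = (\<lambda>i j. if i = j \<and> i \<in> Field r then \<one>\<^bsub>A\<^esub> else \<zero>\<^bsub>A\<^esub>),
      zero = (\<lambda>i j. \<zero>\<^bsub>A\<^esub>),
      add = (\<lambda>a b i j. a i j \<oplus>\<^bsub>A\<^esub> b i j)\<rparr>"

definition single_entry :: "('a, 'm) ring_scheme \<Rightarrow> 'a \<Rightarrow> 'i \<Rightarrow> 'i \<Rightarrow> ('i \<Rightarrow> 'i \<Rightarrow> 'a)" where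
  "single_entry A a i j = (\<lambda>k l. if k = i \<and> l = j then a else \<zero>\<^bsub>A\<^esub>)"

definition UT_component :: "'i rel \<Rightarrow> ('a, 'm) ring_scheme \<Rightarrow> 'i \<times> 'i \<Rightarrow> ('i \<Rightarrow> 'i \<Rightarrow> 'a) set" where
  "UT_component r A = (\<lambda>(i, j).
     if (i, j) \<in> r then (\<lambda>a. single_entry A a i j) ` carrier A else {\<zero>\<^bsub>UT r A\<^esub>})"

definition UT_id :: "('a, 'm) ring_scheme \<Rightarrow> 'i \<times> 'i \<Rightarrow> ('i \<Rightarrow> 'i \<Rightarrow> 'a)" where
  "UT_id A = (\<lambda>(i, j). single_entry A \<one>\<^bsub>A\<^esub> i j)"


section \<open>Ordinals\<close>

text \<open>As in the HOL library, an ordinal \<open>\<lambda>\<close> is represented by a well-order relation \<open>r\<close> of that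
  order type: the set of ordinals less than \<open>\<lambda>\<close> with its usual order is isomorphic to
  \<^term>\<open>Field r\<close> ordered by \<open>r\<close>. The ordinal \<open>\<omega>\<close> is \<^term>\<open>natLeq\<close>, and \<^term>\<open>natLeq <o r\<close>, which
  includes \<^term>\<open>Well_order r\<close>, says that \<open>\<omega> < \<lambda>\<close> (ordinals, not cardinals, are compared).\<close>

end

theory Submission imports Defs begin

text \<open>The left module \<open>R 1\<^sub>e\<close> for \<open>e = (j, j)\<close> is the \<open>j\<close>-th column of the matrix ring. Because it is
  graded, a graded submodule \<open>N\<close> is known from its entries: it is determined by the sets
  \<open>L\<^sub>i = {a. a E\<^sub>i\<^sub>j \<in> N}\<close>. These are left ideals of \<open>A\<close>, and \<open>E\<^sub>i\<^sub>k (a E\<^sub>k\<^sub>j) = a E\<^sub>i\<^sub>j\<close> for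
  \<open>i \<le> k\<close> makes them decrease as the row index grows. A descending chain of graded submodules is thus a
  family of left ideals indexed by pairs (step, row) that decreases in both indices. Such a
  family stabilises for all rows at once: otherwise, at each step \<open>n\<close> take the least row \<open>i\<close> that still
  changes after step \<open>n\<close>. This row can only move up as \<open>n\<close> grows, so following it until it has changed, and
  then passing to the next such row, gives an infinite strictly descending chain of left ideals of
  \<open>A\<close>. The lemma \<open>dcc_if_antitone_families\<close> is this argument, and
  \<open>left_Gamma0_artinian_UT\<close> applies it.

  The ascending chain condition fails in a column \<open>w\<close> that has a copy \<open>s 0 < s 1 < \<dots>\<close> of \<open>\<omega>\<close> below it:
  the matrices in that column whose rows are at most \<open>s n\<close> form a graded submodule, and these grow
  strictly with \<open>n\<close>. The hypothesis \<open>\<omega> < \<lambda>\<close> provides such a column, the one of index \<open>\<omega>\<close>.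

  The second part is the mirror image, with rows for columns and the reversed order for the given one.
  The matrix computations are therefore carried out for an arbitrary preorder \<open>r\<close>, and
  the well-order is assumed of \<open>r\<close> on the left and of \<open>r\<inverse>\<close> on the right.\<close>

section \<open>A descending chain condition for antitone families\<close>

lemma dcc_imp_minimal:
  assumes "dcc \<S>" "T \<subseteq> \<S>" "T \<noteq> {}"
  shows "\<exists>X\<in>T. \<forall>Y\<in>T. \<not> Y \<subset> X"
proof -
  have "wf {(X, Y). X \<in> \<S> \<and> Y \<in> \<S> \<and> X \<subset> Y}"
    unfolding wf_iff_no_infinite_down_chain
  proof
    assume "\<exists>f :: nat \<Rightarrow> _. \<forall>i. (f (Suc i), f i) \<in> {(X, Y). X \<in> \<S> \<and> Y \<in> \<S> \<and> X \<subset> Y}"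
    then obtain f :: "nat \<Rightarrow> 'a set" where f: "\<And>i. f i \<in> \<S>" "\<And>i. f (Suc i) \<subset> f i"
      by blast
    have "antimono f"
      using f(2) by (simp add: antimono_iff_le_Suc less_imp_le)
    then obtain m where "\<forall>n\<ge>m. f n = f m"
      using assms(1) f(1) unfolding dcc_def by blast
    with f(2)[of m] show False by (metis le_Suc_eq psubset_eq order_refl)
  qed
  then show ?thesis
    using assms(2,3) by (auto simp: wf_eq_minimal) (metis psubsetE psubsetI subset_eq)
qed

text \<open>Each \<open>N\<close> is encoded by the family \<open>\<phi> N\<close>, which decreases along a well-order. Among the values
  \<open>\<phi> (f n) i\<close>, where \<open>i\<close> is the least index at which the family still changes after step \<open>n\<close>, there
  would be a minimal one; waiting until that change has happened and taking the new least index
  produces a strictly smaller value.\<close>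

lemma dcc_if_antitone_families:
  fixes \<phi> :: "'b set \<Rightarrow> 'i \<Rightarrow> 'a set"
  assumes r: "Well_order r" and J: "J \<subseteq> Field r" and L: "dcc \<L>"
    and closed: "\<And>N i. N \<in> \<S> \<Longrightarrow> i \<in> J \<Longrightarrow> \<phi> N i \<in> \<L>"
    and mono: "\<And>N N' i. N \<in> \<S> \<Longrightarrow> N' \<in> \<S> \<Longrightarrow> N \<subseteq> N' \<Longrightarrow> i \<in> J \<Longrightarrow> \<phi> N i \<subseteq> \<phi> N' i"
    and anti: "\<And>N i k. N \<in> \<S> \<Longrightarrow> i \<in> J \<Longrightarrow> k \<in> J \<Longrightarrow> (i, k) \<in> r \<Longrightarrow> \<phi> N k \<subseteq> \<phi> N i"
    and inj: "\<And>N N'. N \<in> \<S> \<Longrightarrow> N' \<in> \<S> \<Longrightarrow> (\<And>i. i \<in> J \<Longrightarrow> \<phi> N i = \<phi> N' i) \<Longrightarrow> N = N'"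
  shows "dcc \<S>"
  unfolding dcc_def
proof (intro allI impI)
  fix f :: "nat \<Rightarrow> 'b set"
  assume f: "range f \<subseteq> \<S> \<and> antimono f"
  then have fS: "f n \<in> \<S>" for n by auto
  have sub: "f n \<subseteq> f m" if "m \<le> n" for m n
    using antimonoD[OF conjunct2[OF f] that] .
  have dec: "\<phi> (f n) i \<subseteq> \<phi> (f m) i" if "m \<le> n" "i \<in> J" for m n i
    using fS sub[OF that(1)] that(2) by (intro mono)
  show "\<exists>m. \<forall>n\<ge>m. f n = f m"
  proof (rule ccontr)
    assume never: "\<nexists>m. \<forall>n\<ge>m. f n = f m"
    \<comment> \<open>the indices at which the family still changes after step \<open>n\<close>\<close>
    define D where "D n = {i \<in> J. \<exists>m\<ge>n. \<phi> (f m) i \<noteq> \<phi> (f n) i}" for n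
    have D_ne: "D n \<noteq> {}" for n
      using never inj[OF fS fS] unfolding D_def by blast
    have D_least: "\<exists>i\<in>D n. \<forall>k\<in>D n. (i, k) \<in> r" for n
    proof -
      have "D n \<subseteq> Field r" using J by (auto simp: D_def)
      then have "wo_rel.minim r (D n) \<in> D n" "\<forall>k\<in>D n. (wo_rel.minim r (D n), k) \<in> r"
        using r D_ne[of n] wo_rel.minim_in[of r "D n"] wo_rel.minim_least[of r "D n"]
        by (auto simp: wo_rel_def)
      then show ?thesis by blast
    qed
    define T where "T = {\<phi> (f n) i | n i. i \<in> D n \<and> (\<forall>k\<in>D n. (i, k) \<in> r)}"
    have "T \<subseteq> \<L>" using closed fS by (auto simp: T_def D_def)
    moreover have "T \<noteq> {}" using D_least[of 0] by (auto simp: T_def)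
    ultimately obtain X where X: "X \<in> T" "\<forall>Y\<in>T. \<not> Y \<subset> X"
      using dcc_imp_minimal[OF L] by blast
    then obtain n i where i: "X = \<phi> (f n) i" "i \<in> D n" "\<forall>k\<in>D n. (i, k) \<in> r"
      by (auto simp: T_def)
    then obtain m where m: "i \<in> J" "m \<ge> n" "\<phi> (f m) i \<noteq> \<phi> (f n) i" by (auto simp: D_def)
    obtain k where k: "k \<in> D m" "\<forall>l\<in>D m. (k, l) \<in> r" using D_least[of m] by blast
    then have kJ: "k \<in> J" by (auto simp: D_def)
    \<comment> \<open>A change after step \<open>m\<close> is also a change after the earlier step \<open>n\<close>, the families being
      decreasing in the step; so the least index does not go down from \<open>n\<close> to \<open>m\<close>.\<close>
    have "k \<in> D n"
    proof -
      obtain m' where m': "m' \<ge> m" "\<phi> (f m') k \<noteq> \<phi> (f m) k" using k(1) by (auto simp: D_def)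
      then have "\<phi> (f m') k \<noteq> \<phi> (f n) k" using dec[OF m'(1) kJ] dec[OF m(2) kJ] by blast
      then show ?thesis using m' m(2) kJ by (auto simp: D_def intro!: exI[of _ m'])
    qed
    then have "(i, k) \<in> r" using i by blast
    then have "\<phi> (f m) k \<subseteq> \<phi> (f m) i" using anti[OF fS m(1) kJ] by blast
    then have "\<phi> (f m) k \<subset> X" using i(1) m(3) dec[OF m(2,1)] by blast
    moreover have "\<phi> (f m) k \<in> T" using k by (auto simp: T_def)
    ultimately show False using X(2) by blast
  qed
qed

section \<open>Finite sums and the pair groupoid\<close>

lemma (in abelian_monoid) finsum_swap:
  assumes "finite S" "finite T" "\<And>x y. x \<in> S \<Longrightarrow> y \<in> T \<Longrightarrow> f x y \<in> carrier G"
  shows "(\<Oplus>x\<in>S. \<Oplus>y\<in>T. f x y) = (\<Oplus>y\<in>T. \<Oplus>x\<in>S. f x y)"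
  using assms(1,3)
proof (induction S)
  case empty
  then show ?case by (simp add: finsum_zero)
next
  case (insert s S)
  then have "(\<Oplus>x\<in>insert s S. \<Oplus>y\<in>T. f x y) = (\<Oplus>y\<in>T. f s y) \<oplus> (\<Oplus>y\<in>T. \<Oplus>x\<in>S. f x y)"
    by (simp add: Pi_def)
  also have "\<dots> = (\<Oplus>y\<in>T. f s y \<oplus> (\<Oplus>x\<in>S. f x y))"
    using insert by (subst finsum_addf) (auto intro!: finsum_closed)
  also have "\<dots> = (\<Oplus>y\<in>T. \<Oplus>x\<in>insert s S. f x y)"
    using insert by (intro finsum_cong) (auto simp: Pi_def simp_implies_def)
  finally show ?case .
qed

lemma (in abelian_group) finsum_in_additive_subgroup:
  assumes "additive_subgroup N G" "\<And>x. x \<in> F \<Longrightarrow> f x \<in> N"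
  shows "(\<Oplus>x\<in>F. f x) \<in> N"
proof -
  interpret N: additive_subgroup N G by fact
  show ?thesis
    using assms(2)
  proof (induction F rule: infinite_finite_induct)
    case (insert x F)
    then show ?case by (subst finsum_insert) (auto simp: N.a_Hcarr)
  qed (simp_all add: finsum_infinite)
qed

lemma groupoid_pair_groupoid: "groupoid (pair_groupoid I)"
proof unfold_locales
  fix g assume "g \<in> arrows (pair_groupoid I)"
  then show "\<exists>h\<in>arrows (pair_groupoid I). gdom (pair_groupoid I) h = gran (pair_groupoid I) g \<and>
      gran (pair_groupoid I) h = gdom (pair_groupoid I) g \<and>
      gcomp (pair_groupoid I) h g = gdom (pair_groupoid I) g \<and>
      gcomp (pair_groupoid I) g h = gran (pair_groupoid I) g"
    by (cases g) (auto simp: pair_groupoid_def intro!: bexI[of _ "prod.swap g"])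
qed (auto simp: pair_groupoid_def objects_def)

lemma objects_pair_groupoid: "objects (pair_groupoid I) = (\<lambda>i. (i, i)) ` I"
  by (auto simp: objects_def pair_groupoid_def)

section \<open>The ring of upper triangular matrices\<close>

text \<open>Reflexivity puts the diagonal units \<open>E\<^sub>i\<^sub>i\<close> into the ring and transitivity makes it closed under
  products. Both properties pass to \<open>r\<inverse>\<close>, so that the locale covers the reversed order too.\<close>

locale upper_triangular = ring A for A :: "('a, 'm) ring_scheme" (structure) +
  fixes r :: "'i rel"
  assumes refl_r: "i \<in> Field r \<Longrightarrow> (i, i) \<in> r"
    and trans_r: "(i, j) \<in> r \<Longrightarrow> (j, k) \<in> r \<Longrightarrow> (i, k) \<in> r"
begin

lemma in_UT_iff:
  "M \<in> carrier (UT r A) \<longleftrightarrow>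
     (\<forall>i j. M i j \<in> carrier A) \<and> finite {(i, j). M i j \<noteq> \<zero>} \<and> (\<forall>i j. (i, j) \<notin> r \<longrightarrow> M i j = \<zero>)"
  by (simp add: UT_def)

lemma UT_entry [simp]: "M \<in> carrier (UT r A) \<Longrightarrow> M i j \<in> carrier A"
  by (simp add: in_UT_iff)

lemma UT_add [simp]: "M \<oplus>\<^bsub>UT r A\<^esub> N = (\<lambda>i j. M i j \<oplus> N i j)"
  by (simp only: UT_def ring.simps)

lemma UT_zero [simp]: "\<zero>\<^bsub>UT r A\<^esub> = (\<lambda>i j. \<zero>)"
  by (simp only: UT_def ring.simps)

lemma UT_mult: "(M \<otimes>\<^bsub>UT r A\<^esub> N) i j = (\<Oplus>k\<in>{k. M i k \<otimes> N k j \<noteq> \<zero>}. M i k \<otimes> N k j)"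
  by (simp only: UT_def monoid.simps)

lemma finite_row: "M \<in> carrier (UT r A) \<Longrightarrow> finite {k. M i k \<noteq> \<zero>}"
  by (rule finite_subset[of _ "snd ` {(i, j). M i j \<noteq> \<zero>}"]) (force simp: in_UT_iff)+

lemma finite_column: "M \<in> carrier (UT r A) \<Longrightarrow> finite {k. M k j \<noteq> \<zero>}"
  by (rule finite_subset[of _ "fst ` {(i, j). M i j \<noteq> \<zero>}"]) (force simp: in_UT_iff)+

text \<open>The product is defined with the exact support of its summands as index set, which varies with
  the factors; comparing two products requires a common finite index set.\<close>

lemma UT_mult_entry:
  assumes M: "\<And>i j. M i j \<in> carrier A" and N: "\<And>i j. N i j \<in> carrier A"
    and K: "finite K" "{k. M i k \<otimes> N k j \<noteq> \<zero>} \<subseteq> K"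
  shows "(M \<otimes>\<^bsub>UT r A\<^esub> N) i j = (\<Oplus>k\<in>K. M i k \<otimes> N k j)"
  unfolding UT_mult using M N K(2)
  by (intro add.finprod_mono_neutral_cong_left[OF K(1)]) (auto simp: Pi_def)

lemma UT_mult_entry_closed:
  assumes M: "\<And>i j. M i j \<in> carrier A" and N: "\<And>i j. N i j \<in> carrier A"
  shows "(M \<otimes>\<^bsub>UT r A\<^esub> N) i j \<in> carrier A"
  unfolding UT_mult using M N by (intro finsum_closed) simp

lemma UT_mult_nonzero:
  assumes "(M \<otimes>\<^bsub>UT r A\<^esub> N) i j \<noteq> \<zero>"
    and M: "\<And>i j. M i j \<in> carrier A" and N: "\<And>i j. N i j \<in> carrier A"
  obtains k where "M i k \<noteq> \<zero>" "N k j \<noteq> \<zero>"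
proof -
  have "{k. M i k \<otimes> N k j \<noteq> \<zero>} \<noteq> {}"
    using assms(1) unfolding UT_mult by (intro notI) (simp only: finsum_empty simp_thms)
  then obtain k where "M i k \<otimes> N k j \<noteq> \<zero>" by blast
  then show ?thesis using that[of k] M N by force
qed

lemma UT_mult_closed:
  assumes M: "M \<in> carrier (UT r A)" and N: "N \<in> carrier (UT r A)"
  shows "M \<otimes>\<^bsub>UT r A\<^esub> N \<in> carrier (UT r A)"
proof -
  have nz: "\<exists>k. M i k \<noteq> \<zero> \<and> N k j \<noteq> \<zero>" if "(M \<otimes>\<^bsub>UT r A\<^esub> N) i j \<noteq> \<zero>" for i j
    using UT_mult_nonzero[OF that] M N by (metis UT_entry)
  have "{(i, j). (M \<otimes>\<^bsub>UT r A\<^esub> N) i j \<noteq> \<zero>}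
      \<subseteq> fst ` {(i, j). M i j \<noteq> \<zero>} \<times> snd ` {(i, j). N i j \<noteq> \<zero>}"
    using nz by force
  moreover have "finite (fst ` {(i, j). M i j \<noteq> \<zero>} \<times> snd ` {(i, j). N i j \<noteq> \<zero>})"
    using M N by (simp add: in_UT_iff)
  ultimately have "finite {(i, j). (M \<otimes>\<^bsub>UT r A\<^esub> N) i j \<noteq> \<zero>}"
    by (rule finite_subset)
  moreover have "(M \<otimes>\<^bsub>UT r A\<^esub> N) i j = \<zero>" if "(i, j) \<notin> r" for i j
    using nz[of i j] that trans_r M N by (metis in_UT_iff)
  moreover have "(M \<otimes>\<^bsub>UT r A\<^esub> N) i j \<in> carrier A" for i j
    using UT_mult_entry_closed M N by simp
  ultimately show ?thesis unfolding in_UT_iff by blast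
qed

lemma UT_add_closed:
  assumes M: "M \<in> carrier (UT r A)" and N: "N \<in> carrier (UT r A)"
  shows "M \<oplus>\<^bsub>UT r A\<^esub> N \<in> carrier (UT r A)"
proof -
  have "finite ({(i, j). M i j \<noteq> \<zero>} \<union> {(i, j). N i j \<noteq> \<zero>})"
    using M N by (simp add: in_UT_iff)
  then have "finite {(i, j). M i j \<oplus> N i j \<noteq> \<zero>}"
    by (rule rev_finite_subset) auto
  with M N show ?thesis by (simp add: in_UT_iff)
qed

lemma UT_minus_closed:
  assumes M: "M \<in> carrier (UT r A)"
  shows "(\<lambda>i j. \<ominus> M i j) \<in> carrier (UT r A)"
proof -
  have "{(i, j). \<ominus> M i j \<noteq> \<zero>} \<subseteq> {(i, j). M i j \<noteq> \<zero>}" by auto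
  then have "finite {(i, j). \<ominus> M i j \<noteq> \<zero>}"
    using M by (auto simp: in_UT_iff dest: finite_subset)
  with M show ?thesis by (simp add: in_UT_iff)
qed

lemma abelian_group_UT: "abelian_group (UT r A)"
proof (rule abelian_groupI)
  show "\<zero>\<^bsub>UT r A\<^esub> \<in> carrier (UT r A)" by (simp add: in_UT_iff)
  fix M assume M: "M \<in> carrier (UT r A)"
  show "\<exists>N\<in>carrier (UT r A). N \<oplus>\<^bsub>UT r A\<^esub> M = \<zero>\<^bsub>UT r A\<^esub>"
    using M by (intro bexI[OF _ UT_minus_closed[OF M]]) (simp add: l_neg)
  show "\<zero>\<^bsub>UT r A\<^esub> \<oplus>\<^bsub>UT r A\<^esub> M = M"
    using M by simp
qed (use UT_add_closed in \<open>auto simp: a_ac\<close>)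

lemma UT_mult_assoc:
  assumes M: "M \<in> carrier (UT r A)" and N: "N \<in> carrier (UT r A)" and P: "P \<in> carrier (UT r A)"
  shows "(M \<otimes>\<^bsub>UT r A\<^esub> N) \<otimes>\<^bsub>UT r A\<^esub> P = M \<otimes>\<^bsub>UT r A\<^esub> (N \<otimes>\<^bsub>UT r A\<^esub> P)"
proof (intro ext)
  fix i j
  note entries = UT_entry[OF M] UT_entry[OF N] UT_entry[OF P]
  define K where "K = {k. M i k \<noteq> \<zero>}"
  define L where "L = {l. P l j \<noteq> \<zero>}"
  have fin: "finite K" "finite L"
    unfolding K_def L_def using finite_row[OF M] finite_column[OF P] by auto
  have "((M \<otimes>\<^bsub>UT r A\<^esub> N) \<otimes>\<^bsub>UT r A\<^esub> P) i j = (\<Oplus>l\<in>L. (M \<otimes>\<^bsub>UT r A\<^esub> N) i l \<otimes> P l j)"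
    using entries UT_mult_entry_closed[OF entries(1,2)] fin
    by (intro UT_mult_entry) (auto simp: L_def)
  also have "\<dots> = (\<Oplus>l\<in>L. \<Oplus>k\<in>K. M i k \<otimes> N k l \<otimes> P l j)"
  proof (intro finsum_cong refl)
    fix l
    have "(M \<otimes>\<^bsub>UT r A\<^esub> N) i l = (\<Oplus>k\<in>K. M i k \<otimes> N k l)"
      using entries fin by (intro UT_mult_entry) (auto simp: K_def)
    then show "l \<in> L =simp=> (M \<otimes>\<^bsub>UT r A\<^esub> N) i l \<otimes> P l j = (\<Oplus>k\<in>K. M i k \<otimes> N k l \<otimes> P l j)"
      using entries fin by (simp add: finsum_ldistr simp_implies_def)
  qed (use entries UT_mult_entry_closed[OF entries(1,2)] in \<open>auto intro!: finsum_closed\<close>)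
  also have "\<dots> = (\<Oplus>k\<in>K. \<Oplus>l\<in>L. M i k \<otimes> N k l \<otimes> P l j)"
    using entries fin by (intro finsum_swap) auto
  also have "\<dots> = (\<Oplus>k\<in>K. M i k \<otimes> (N \<otimes>\<^bsub>UT r A\<^esub> P) k j)"
  proof (intro finsum_cong refl)
    fix k
    have "(N \<otimes>\<^bsub>UT r A\<^esub> P) k j = (\<Oplus>l\<in>L. N k l \<otimes> P l j)"
      using entries fin by (intro UT_mult_entry) (auto simp: L_def)
    then show "k \<in> K =simp=> (\<Oplus>l\<in>L. M i k \<otimes> N k l \<otimes> P l j) = M i k \<otimes> (N \<otimes>\<^bsub>UT r A\<^esub> P) k j"
      using entries fin by (simp add: finsum_rdistr simp_implies_def m_assoc)
  qed (use entries UT_mult_entry_closed[OF entries(2,3)] in \<open>auto intro!: finsum_closed\<close>)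
  also have "\<dots> = (M \<otimes>\<^bsub>UT r A\<^esub> (N \<otimes>\<^bsub>UT r A\<^esub> P)) i j"
    using entries UT_mult_entry_closed[OF entries(2,3)] fin
    by (intro UT_mult_entry[symmetric]) (auto simp: K_def)
  finally show "((M \<otimes>\<^bsub>UT r A\<^esub> N) \<otimes>\<^bsub>UT r A\<^esub> P) i j = (M \<otimes>\<^bsub>UT r A\<^esub> (N \<otimes>\<^bsub>UT r A\<^esub> P)) i j" .
qed

lemma rng_UT: "rng (UT r A)"
proof -
  interpret U: abelian_group "UT r A" by (rule abelian_group_UT)
  show ?thesis
  proof unfold_locales
    fix M N P
    assume M: "M \<in> carrier (UT r A)" and N: "N \<in> carrier (UT r A)" and P: "P \<in> carrier (UT r A)"
    note entries = UT_entry[OF M] UT_entry[OF N] UT_entry[OF P]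
    show "M \<otimes>\<^bsub>UT r A\<^esub> N \<in> carrier (UT r A)" using M N by (rule UT_mult_closed)
    show "(M \<otimes>\<^bsub>UT r A\<^esub> N) \<otimes>\<^bsub>UT r A\<^esub> P = M \<otimes>\<^bsub>UT r A\<^esub> (N \<otimes>\<^bsub>UT r A\<^esub> P)"
      using M N P by (rule UT_mult_assoc)
    show "(M \<oplus>\<^bsub>UT r A\<^esub> N) \<otimes>\<^bsub>UT r A\<^esub> P = M \<otimes>\<^bsub>UT r A\<^esub> P \<oplus>\<^bsub>UT r A\<^esub> N \<otimes>\<^bsub>UT r A\<^esub> P"
    proof (intro ext)
      fix i j
      define K where "K = {k. P k j \<noteq> \<zero>}"
      have K: "finite K" unfolding K_def by (rule finite_column[OF P])
      have "(Q \<otimes>\<^bsub>UT r A\<^esub> P) i j = (\<Oplus>k\<in>K. Q i k \<otimes> P k j)" if "\<And>i j. Q i j \<in> carrier A" for Q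
        using entries that K by (intro UT_mult_entry) (auto simp: K_def)
      from this[of "M \<oplus>\<^bsub>UT r A\<^esub> N"] this[of M] this[of N]
      show "((M \<oplus>\<^bsub>UT r A\<^esub> N) \<otimes>\<^bsub>UT r A\<^esub> P) i j = (M \<otimes>\<^bsub>UT r A\<^esub> P \<oplus>\<^bsub>UT r A\<^esub> N \<otimes>\<^bsub>UT r A\<^esub> P) i j"
        using entries by (simp add: l_distr finsum_addf Pi_def)
    qed
    show "P \<otimes>\<^bsub>UT r A\<^esub> (M \<oplus>\<^bsub>UT r A\<^esub> N) = P \<otimes>\<^bsub>UT r A\<^esub> M \<oplus>\<^bsub>UT r A\<^esub> P \<otimes>\<^bsub>UT r A\<^esub> N"
    proof (intro ext)
      fix i j
      define K where "K = {k. P i k \<noteq> \<zero>}"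
      have K: "finite K" unfolding K_def by (rule finite_row[OF P])
      have "(P \<otimes>\<^bsub>UT r A\<^esub> Q) i j = (\<Oplus>k\<in>K. P i k \<otimes> Q k j)" if "\<And>i j. Q i j \<in> carrier A" for Q
        using entries that K by (intro UT_mult_entry) (auto simp: K_def)
      from this[of "M \<oplus>\<^bsub>UT r A\<^esub> N"] this[of M] this[of N]
      show "(P \<otimes>\<^bsub>UT r A\<^esub> (M \<oplus>\<^bsub>UT r A\<^esub> N)) i j = (P \<otimes>\<^bsub>UT r A\<^esub> M \<oplus>\<^bsub>UT r A\<^esub> P \<otimes>\<^bsub>UT r A\<^esub> N) i j"
        using entries by (simp add: r_distr finsum_addf Pi_def)
    qed
  qed
qed

section \<open>Homogeneous components and graded subgroups\<close>

lemma single_entry_closed: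
  assumes "a \<in> carrier A" "(i, j) \<in> r"
  shows "single_entry A a i j \<in> carrier (UT r A)"
proof -
  have "{(k, l). single_entry A a i j k l \<noteq> \<zero>} \<subseteq> {(i, j)}"
    by (auto simp: single_entry_def split: if_splits)
  then have "finite {(k, l). single_entry A a i j k l \<noteq> \<zero>}"
    by (rule finite_subset) simp
  with assms show ?thesis by (auto simp: in_UT_iff single_entry_def)
qed

lemma single_entry_mult:
  assumes "a \<in> carrier A" "\<And>k l. M k l \<in> carrier A"
  shows "single_entry A a i j \<otimes>\<^bsub>UT r A\<^esub> M = (\<lambda>k l. if k = i then a \<otimes> M j l else \<zero>)"
  using assms
  by (intro ext, subst UT_mult_entry[of _ _ "{j}"]) (auto simp: single_entry_def)

lemma mult_single_entry:
  assumes "a \<in> carrier A" "\<And>k l. M k l \<in> carrier A"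
  shows "M \<otimes>\<^bsub>UT r A\<^esub> single_entry A a i j = (\<lambda>k l. if l = j then M k i \<otimes> a else \<zero>)"
  using assms
  by (intro ext, subst UT_mult_entry[of _ _ "{i}"]) (auto simp: single_entry_def)

lemma single_entry_mult_single_entry:
  assumes "a \<in> carrier A" "b \<in> carrier A"
  shows "single_entry A a i j \<otimes>\<^bsub>UT r A\<^esub> single_entry A b k l =
    (if j = k then single_entry A (a \<otimes> b) i l else \<zero>\<^bsub>UT r A\<^esub>)"
  using assms by (subst single_entry_mult) (auto simp: single_entry_def fun_eq_iff)

lemma single_entry_add:
  assumes "a \<in> carrier A" "b \<in> carrier A"
  shows "single_entry A (a \<oplus> b) i j = single_entry A a i j \<oplus>\<^bsub>UT r A\<^esub> single_entry A b i j"
  using assms by (auto simp: single_entry_def fun_eq_iff)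

lemma single_entry_zero: "single_entry A \<zero> i j = \<zero>\<^bsub>UT r A\<^esub>"
  by (auto simp: single_entry_def fun_eq_iff)

lemma UT_a_inv:
  assumes "M \<in> carrier (UT r A)"
  shows "\<ominus>\<^bsub>UT r A\<^esub> M = (\<lambda>i j. \<ominus> M i j)"
proof -
  interpret U: abelian_group "UT r A" by (rule abelian_group_UT)
  show ?thesis
    using assms UT_minus_closed[OF assms] by (intro U.minus_equality) (auto simp: l_neg)
qed

lemma additive_subgroup_UT_iff:
  "additive_subgroup N (UT r A) \<longleftrightarrow> N \<subseteq> carrier (UT r A) \<and> \<zero>\<^bsub>UT r A\<^esub> \<in> N \<and>
     (\<forall>M\<in>N. \<forall>M'\<in>N. M \<oplus>\<^bsub>UT r A\<^esub> M' \<in> N) \<and> (\<forall>M\<in>N. (\<lambda>i j. \<ominus> M i j) \<in> N)" (is "_ \<longleftrightarrow> ?rhs")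
proof
  assume "additive_subgroup N (UT r A)"
  then interpret additive_subgroup N "UT r A" .
  have "(\<lambda>i j. \<ominus> M i j) \<in> N" if "M \<in> N" for M
    using a_inv_closed[OF that] UT_a_inv[of M] a_subset that by (metis subsetD)
  then show ?rhs
    using a_subset a_closed zero_closed by blast
next
  assume rhs: ?rhs
  interpret U: abelian_group "UT r A" by (rule abelian_group_UT)
  show "additive_subgroup N (UT r A)"
  proof (intro additive_subgroupI U.add.subgroupI)
    fix M assume M: "M \<in> N"
    then have "\<ominus>\<^bsub>UT r A\<^esub> M = (\<lambda>i j. \<ominus> M i j)"
      using rhs by (intro UT_a_inv) blast
    then show "\<ominus>\<^bsub>UT r A\<^esub> M \<in> N"
      using rhs M by metis
  qed (use rhs in auto)
qed

text \<open>The two cases of the definition merge, since the zero matrix is \<open>0 E\<^sub>i\<^sub>j\<close>.\<close>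

lemma in_UT_component_iff:
  "M \<in> UT_component r A (i, j) \<longleftrightarrow>
    (\<exists>a\<in>carrier A. M = single_entry A a i j \<and> ((i, j) \<notin> r \<longrightarrow> a = \<zero>))"
  using single_entry_zero[of i j] by (auto simp: UT_component_def)

lemma UT_component_eq_single_entry:
  assumes "M \<in> UT_component r A (i, j)"
  shows "M = single_entry A (M i j) i j"
  using assms unfolding in_UT_component_iff by (auto simp: single_entry_def)

lemma UT_component_closed: "UT_component r A g \<subseteq> carrier (UT r A)"
proof -
  have "(\<lambda>i j. \<zero>) \<in> carrier (UT r A)" by (simp add: in_UT_iff)
  then show ?thesis by (cases g) (auto simp: UT_component_def single_entry_closed)
qed

lemma additive_subgroup_UT_component: "additive_subgroup (UT_component r A g) (UT r A)"
proof (cases g)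
  case (Pair i j)
  have "\<zero>\<^bsub>UT r A\<^esub> \<in> UT_component r A (i, j)"
    using single_entry_zero[of i j, symmetric] unfolding in_UT_component_iff by blast
  moreover have "M \<oplus>\<^bsub>UT r A\<^esub> M' \<in> UT_component r A (i, j)"
    if M: "M \<in> UT_component r A (i, j)" and M': "M' \<in> UT_component r A (i, j)" for M M'
  proof -
    obtain a where a: "a \<in> carrier A" "M = single_entry A a i j" "(i, j) \<notin> r \<Longrightarrow> a = \<zero>"
      using M unfolding in_UT_component_iff by blast
    obtain b where b: "b \<in> carrier A" "M' = single_entry A b i j" "(i, j) \<notin> r \<Longrightarrow> b = \<zero>"
      using M' unfolding in_UT_component_iff by blast
    show ?thesis
      unfolding in_UT_component_iff a(2) b(2) using a(1,3) b(1,3) single_entry_add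
      by (intro bexI[of _ "a \<oplus> b"]) simp_all
  qed
  moreover have "(\<lambda>k l. \<ominus> M k l) \<in> UT_component r A (i, j)"
    if M: "M \<in> UT_component r A (i, j)" for M
  proof -
    obtain a where a: "a \<in> carrier A" "M = single_entry A a i j" "(i, j) \<notin> r \<Longrightarrow> a = \<zero>"
      using M unfolding in_UT_component_iff by blast
    then have "(\<lambda>k l. \<ominus> M k l) = single_entry A (\<ominus> a) i j"
      by (auto simp: single_entry_def fun_eq_iff)
    then show ?thesis
      unfolding in_UT_component_iff using a(1,3) by (intro bexI[of _ "\<ominus> a"]) simp_all
  qed
  ultimately show ?thesis
    unfolding additive_subgroup_UT_iff Pair using UT_component_closed by blast
qed

lemma additive_subgroup_Int_UT_component:
  assumes "additive_subgroup N (UT r A)"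
  shows "additive_subgroup (N \<inter> UT_component r A g) (UT r A)"
  using assms additive_subgroup_UT_component[of g] unfolding additive_subgroup_UT_iff by auto

lemma finsum_UT_entry:
  assumes "\<And>g. g \<in> F \<Longrightarrow> f g \<in> carrier (UT r A)"
  shows "(\<Oplus>\<^bsub>UT r A\<^esub>g\<in>F. f g) k l = (\<Oplus>g\<in>F. f g k l)"
  using assms
proof (induction F rule: infinite_finite_induct)
  case (insert g F)
  interpret U: abelian_group "UT r A" by (rule abelian_group_UT)
  show ?case
    using insert by (subst U.finsum_insert) (auto simp: finsum_insert Pi_def)
next
  case (infinite F)
  interpret U: abelian_group "UT r A" by (rule abelian_group_UT)
  show ?case using infinite by (simp add: U.finsum_infinite finsum_infinite)
next
  case empty
  interpret U: abelian_group "UT r A" by (rule abelian_group_UT)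
  show ?case by simp
qed

text \<open>Only the summand of degree \<open>(k, l)\<close> can contribute to the entry \<open>(k, l)\<close>. This is the reason
  why the components are independent.\<close>

lemma finsum_homogeneous_entry:
  assumes S: "(k, l) \<in> S" and f: "\<And>g. g \<in> S \<Longrightarrow> f g \<in> UT_component r A g"
    and fin: "finite {g \<in> S. f g \<noteq> \<zero>\<^bsub>UT r A\<^esub>}"
  shows "(\<Oplus>\<^bsub>UT r A\<^esub>g\<in>{g \<in> S. f g \<noteq> \<zero>\<^bsub>UT r A\<^esub>}. f g) k l = f (k, l) k l"
proof -
  let ?F = "{g \<in> S. f g \<noteq> \<zero>\<^bsub>UT r A\<^esub>}"
  have closed: "f g \<in> carrier (UT r A)" if "g \<in> S" for g
    using f[OF that] UT_component_closed by blast
  have off: "f g k l = \<zero>" if "g \<in> S" "g \<noteq> (k, l)" for g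
    using UT_component_eq_single_entry[of "f g" "fst g" "snd g"] f[OF that(1)] that(2)
    by (metis (no_types, lifting) prod.collapse single_entry_def)
  have "(\<Oplus>\<^bsub>UT r A\<^esub>g\<in>?F. f g) k l = (\<Oplus>g\<in>?F. f g k l)"
    using closed by (intro finsum_UT_entry) auto
  also have "\<dots> = (\<Oplus>g\<in>{(k, l)}. f g k l)"
    using closed off S fin
    by (intro add.finprod_mono_neutral_cong[symmetric]) auto
  also have "\<dots> = f (k, l) k l"
    using closed[OF S] by simp
  finally show ?thesis .
qed

text \<open>A matrix is the sum of its entries \<open>M k l E\<^sub>k\<^sub>l\<close>, of which finitely many are nonzero. So an additive
  subgroup is graded as soon as it contains the homogeneous parts of its elements, and the decomposition is
  unique because the sum of a homogeneous family has the members of the family as entries.\<close>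

lemma is_graded_if_entrywise:
  assumes N: "additive_subgroup N (UT r A)"
    and entries: "\<And>M k l. M \<in> N \<Longrightarrow> single_entry A (M k l) k l \<in> N"
  shows "internal_direct_sum (UT r A) (arrows (pair_groupoid (Field r)))
    (\<lambda>g. N \<inter> UT_component r A g) N"
proof -
  interpret U: abelian_group "UT r A" by (rule abelian_group_UT)
  interpret N: additive_subgroup N "UT r A" by fact
  define S where "S = Field r \<times> Field r"
  let ?supp = "\<lambda>f. {g \<in> S. f g \<noteq> \<zero>\<^bsub>UT r A\<^esub>}"
  let ?sum = "\<lambda>f. \<Oplus>\<^bsub>UT r A\<^esub>g\<in>?supp f. f g"
  let ?fam = "{f \<in> (\<Pi>\<^sub>E g\<in>S. N \<inter> UT_component r A g). finite (?supp f)}"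
  have sum_entry: "?sum f k l = f (k, l) k l" if "f \<in> ?fam" "(k, l) \<in> S" for f k l
    using that by (intro finsum_homogeneous_entry) auto
  have sum_closed: "?sum f \<in> N" if "f \<in> ?fam" for f
    using that by (intro U.finsum_in_additive_subgroup[OF N]) auto
  have "inj_on ?sum ?fam"
  proof (rule inj_onI)
    fix f f' assume f: "f \<in> ?fam" and f': "f' \<in> ?fam" and eq: "?sum f = ?sum f'"
    have "f (k, l) = f' (k, l)" if "(k, l) \<in> S" for k l
    proof -
      have "f (k, l) \<in> UT_component r A (k, l)" "f' (k, l) \<in> UT_component r A (k, l)"
        using f f' that by auto
      then show ?thesis
        using UT_component_eq_single_entry sum_entry[OF f that] sum_entry[OF f' that] eq by metis
    qed
    then show "f = f'"
      using f f' by (intro PiE_ext[of f S _ f']) auto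
  qed
  moreover have "N \<subseteq> ?sum ` ?fam"
  proof
    fix M assume M: "M \<in> N"
    then have MU: "M \<in> carrier (UT r A)" using N.a_subset by blast
    define f where "f = (\<lambda>g\<in>S. single_entry A (M (fst g) (snd g)) (fst g) (snd g))"
    have f_eq: "f (k, l) = single_entry A (M k l) k l" if "(k, l) \<in> S" for k l
      using that by (simp add: f_def)
    have f_zero: "f (k, l) = \<zero>\<^bsub>UT r A\<^esub> \<longleftrightarrow> M k l = \<zero>" if "(k, l) \<in> S" for k l
      unfolding f_eq[OF that] by (auto simp: single_entry_def fun_eq_iff)
    have "?supp f \<subseteq> {(k, l). M k l \<noteq> \<zero>}"
      using f_zero by auto
    then have "finite (?supp f)"
      using MU by (auto simp: in_UT_iff dest: finite_subset)
    moreover have "f g \<in> N \<inter> UT_component r A g" if "g \<in> S" for g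
    proof (cases g)
      case (Pair k l)
      have "f (k, l) \<in> N" using f_eq that entries[OF M] unfolding Pair by simp
      moreover have "f (k, l) \<in> UT_component r A (k, l)"
        using that MU f_eq f_zero unfolding in_UT_component_iff Pair in_UT_iff by blast
      ultimately show ?thesis unfolding Pair by blast
    qed
    ultimately have fam: "f \<in> ?fam" by (auto simp: f_def)
    have "?sum f k l = M k l" for k l
    proof (cases "(k, l) \<in> S")
      case True
      then show ?thesis using sum_entry[OF fam True] f_eq[OF True] by (simp add: single_entry_def)
    next
      case False
      then have "(k, l) \<notin> r" by (auto simp: S_def intro: FieldI1 FieldI2)
      moreover have "?sum f \<in> carrier (UT r A)" using sum_closed[OF fam] N.a_subset by blast
      ultimately show ?thesis using MU unfolding in_UT_iff by simp
    qed
    then have "M = ?sum f" by (intro ext) simp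
    then show "M \<in> ?sum ` ?fam" using fam by blast
  qed
  ultimately have "bij_betw ?sum ?fam N"
    unfolding bij_betw_def using sum_closed by blast
  then show ?thesis
    unfolding internal_direct_sum_def
    using additive_subgroup_Int_UT_component[OF N] by (simp add: pair_groupoid_def S_def)
qed

text \<open>Taking all positions gives the whole ring, a single column or row gives \<open>R 1\<^sub>e\<close> or
  \<open>1\<^sub>e R\<close>, and parts of these give the ascending chains that do not stop.\<close>

definition supported :: "('i \<times> 'i) set \<Rightarrow> ('i \<Rightarrow> 'i \<Rightarrow> 'a) set" where
  "supported P = {M \<in> carrier (UT r A). \<forall>k l. (k, l) \<notin> P \<longrightarrow> M k l = \<zero>}"

definition entries_at :: "('i \<Rightarrow> 'i \<Rightarrow> 'a) set \<Rightarrow> 'i \<Rightarrow> 'i \<Rightarrow> 'a set" where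
  "entries_at N i j = {a \<in> carrier A. single_entry A a i j \<in> N}"

lemma additive_subgroup_supported: "additive_subgroup (supported P) (UT r A)"
proof -
  have "\<zero>\<^bsub>UT r A\<^esub> \<in> supported P"
    by (simp add: supported_def in_UT_iff)
  moreover have "M \<oplus>\<^bsub>UT r A\<^esub> M' \<in> supported P" if "M \<in> supported P" "M' \<in> supported P" for M M'
    using that UT_add_closed[of M M'] unfolding supported_def by simp
  moreover have "(\<lambda>i j. \<ominus> M i j) \<in> supported P" if "M \<in> supported P" for M
    using that UT_minus_closed[of M] unfolding supported_def by simp
  ultimately show ?thesis
    unfolding additive_subgroup_UT_iff by (auto simp: supported_def)
qed

lemma is_graded_supported:
  "is_graded (pair_groupoid (Field r)) (UT r A) (UT_component r A) (supported P)"
  unfolding is_graded_def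
proof (rule is_graded_if_entrywise[OF additive_subgroup_supported])
  fix M k l assume M: "M \<in> supported P"
  have "single_entry A (M k l) k l \<in> carrier (UT r A)"
  proof (cases "(k, l) \<in> r")
    case True
    with M show ?thesis by (intro single_entry_closed) (simp_all add: supported_def)
  next
    case False
    with M have "M k l = \<zero>" by (simp add: supported_def in_UT_iff)
    then show ?thesis by (simp add: single_entry_zero in_UT_iff)
  qed
  with M show "single_entry A (M k l) k l \<in> supported P"
    by (auto simp: supported_def single_entry_def)
qed

lemma groupoid_graded_ring_UT:
  "groupoid_graded_ring (pair_groupoid (Field r)) (UT r A) (UT_component r A) (UT_id A)"
proof -
  interpret G: groupoid "pair_groupoid (Field r)" by (rule groupoid_pair_groupoid)
  interpret U: rng "UT r A" by (rule rng_UT)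
  show ?thesis
  proof unfold_locales
    have "supported UNIV = carrier (UT r A)" by (simp add: supported_def)
    moreover have "carrier (UT r A) \<inter> UT_component r A g = UT_component r A g" for g
      using UT_component_closed by blast
    ultimately show "internal_direct_sum (UT r A) (arrows (pair_groupoid (Field r)))
        (UT_component r A) (carrier (UT r A))"
      using is_graded_supported[of UNIV] by (simp add: is_graded_def)
  next
    fix g h M N
    assume gh: "gdom (pair_groupoid (Field r)) g = gran (pair_groupoid (Field r)) h"
      and M: "M \<in> UT_component r A g" and N: "N \<in> UT_component r A h"
    obtain i j where g: "g = (i, j)" by (cases g)
    obtain k where h: "h = (j, k)" using gh g by (cases h) (auto simp: pair_groupoid_def)
    obtain a where a: "a \<in> carrier A" "M = single_entry A a i j" "(i, j) \<notin> r \<Longrightarrow> a = \<zero>"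
      using M unfolding g in_UT_component_iff by blast
    obtain b where b: "b \<in> carrier A" "N = single_entry A b j k" "(j, k) \<notin> r \<Longrightarrow> b = \<zero>"
      using N unfolding h in_UT_component_iff by blast
    have "M \<otimes>\<^bsub>UT r A\<^esub> N = single_entry A (a \<otimes> b) i k"
      unfolding a(2) b(2) using single_entry_mult_single_entry[OF a(1) b(1)] by simp
    moreover have "a \<otimes> b = \<zero>" if "(i, k) \<notin> r"
    proof -
      have "a = \<zero> \<or> b = \<zero>" using that trans_r a(3) b(3) by blast
      then show ?thesis using a(1) b(1) by auto
    qed
    ultimately have "M \<otimes>\<^bsub>UT r A\<^esub> N \<in> UT_component r A (i, k)"
      unfolding in_UT_component_iff using a(1) b(1) by blast
    then show "M \<otimes>\<^bsub>UT r A\<^esub> N \<in> UT_component r A (gcomp (pair_groupoid (Field r)) g h)"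
      by (simp add: g h pair_groupoid_def)
  next
    fix g h M N
    assume gh: "gdom (pair_groupoid (Field r)) g \<noteq> gran (pair_groupoid (Field r)) h"
      and M: "M \<in> UT_component r A g" and N: "N \<in> UT_component r A h"
    obtain i j where g: "g = (i, j)" by (cases g)
    obtain k l where h: "h = (k, l)" by (cases h)
    have "j \<noteq> k" using gh g h by (auto simp: pair_groupoid_def)
    moreover obtain a where "a \<in> carrier A" "M = single_entry A a i j"
      using M unfolding g in_UT_component_iff by blast
    moreover obtain b where "b \<in> carrier A" "N = single_entry A b k l"
      using N unfolding h in_UT_component_iff by blast
    ultimately show "M \<otimes>\<^bsub>UT r A\<^esub> N = \<zero>\<^bsub>UT r A\<^esub>"
      using single_entry_mult_single_entry[of a b i j k l] by metis
  next
    fix e assume "e \<in> objects (pair_groupoid (Field r))"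
    then obtain i where "e = (i, i)" "(i, i) \<in> r"
      using refl_r by (auto simp: objects_pair_groupoid)
    then show "UT_id A e \<in> UT_component r A e"
      unfolding UT_id_def using in_UT_component_iff[of _ i i] by auto
  next
    fix g M assume M: "M \<in> UT_component r A g"
    obtain i j where g: "g = (i, j)" by (cases g)
    obtain a where a: "a \<in> carrier A" "M = single_entry A a i j"
      using M unfolding g in_UT_component_iff by blast
    show "UT_id A (gran (pair_groupoid (Field r)) g) \<otimes>\<^bsub>UT r A\<^esub> M = M"
      using single_entry_mult_single_entry[OF one_closed a(1), of i i i j] a
      by (simp add: g UT_id_def pair_groupoid_def)
    show "M \<otimes>\<^bsub>UT r A\<^esub> UT_id A (gdom (pair_groupoid (Field r)) g) = M"
      using single_entry_mult_single_entry[OF a(1) one_closed, of i j j j] a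
      by (simp add: g UT_id_def pair_groupoid_def)
  qed
qed

lemma additive_subgroup_entries_at:
  assumes "additive_subgroup N (UT r A)"
  shows "additive_subgroup (entries_at N i j) A"
proof -
  have N: "\<zero>\<^bsub>UT r A\<^esub> \<in> N" "\<And>M M'. M \<in> N \<Longrightarrow> M' \<in> N \<Longrightarrow> M \<oplus>\<^bsub>UT r A\<^esub> M' \<in> N"
    "\<And>M. M \<in> N \<Longrightarrow> (\<lambda>i j. \<ominus> M i j) \<in> N"
    using assms unfolding additive_subgroup_UT_iff by blast+
  show ?thesis
  proof (intro additive_subgroupI add.subgroupI)
    show "entries_at N i j \<subseteq> carrier A" by (auto simp: entries_at_def)
    have "\<zero> \<in> entries_at N i j"
      using N(1) single_entry_zero[of i j] unfolding entries_at_def by (intro CollectI conjI) simp_all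
    then show "entries_at N i j \<noteq> {}" by blast
  next
    fix a assume a: "a \<in> entries_at N i j"
    have "single_entry A (\<ominus> a) i j = (\<lambda>k l. \<ominus> single_entry A a i j k l)"
      by (auto simp: single_entry_def fun_eq_iff)
    then show "\<ominus> a \<in> entries_at N i j"
      using N(3)[of "single_entry A a i j"] a unfolding entries_at_def by simp
  next
    fix a b assume "a \<in> entries_at N i j" "b \<in> entries_at N i j"
    then show "a \<oplus> b \<in> entries_at N i j"
      using N(2)[of "single_entry A a i j" "single_entry A b i j"] single_entry_add[of a b i j]
      unfolding entries_at_def by simp
  qed
qed

text \<open>A graded subgroup is the image of the summation map on families in its components, so it is
  known from them; the components of degree outside \<open>r\<close> are zero and carry no information.\<close>

lemma graded_eqI:
  assumes N: "is_graded (pair_groupoid (Field r)) (UT r A) (UT_component r A) N"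
      "additive_subgroup N (UT r A)"
    and N': "is_graded (pair_groupoid (Field r)) (UT r A) (UT_component r A) N'"
      "additive_subgroup N' (UT r A)"
    and eq: "\<And>i j. (i, j) \<in> r \<Longrightarrow> entries_at N i j = entries_at N' i j"
  shows "N = N'"
proof -
  have "M \<in> N \<longleftrightarrow> M \<in> N'" if M: "M \<in> UT_component r A g" for g M
  proof -
    obtain i j where g: "g = (i, j)" by (cases g)
    obtain a where a: "a \<in> carrier A" "M = single_entry A a i j" "(i, j) \<notin> r \<Longrightarrow> a = \<zero>"
      using M unfolding g in_UT_component_iff by blast
    show ?thesis
    proof (cases "(i, j) \<in> r")
      case True
      then show ?thesis using eq[OF True] a(1) unfolding entries_at_def a(2) by blast
    next
      case False
      then have "M = \<zero>\<^bsub>UT r A\<^esub>" using a(2,3) single_entry_zero by simp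
      then show ?thesis using N(2) N'(2) unfolding additive_subgroup_UT_iff by blast
    qed
  qed
  then have "(\<lambda>g. N \<inter> UT_component r A g) = (\<lambda>g. N' \<inter> UT_component r A g)" by blast
  then show ?thesis
    using N(1) N'(1) unfolding is_graded_def internal_direct_sum_def bij_betw_def by simp
qed

section \<open>Graded submodules of columns and rows\<close>

text \<open>Right multiplication by \<open>E\<^sub>j\<^sub>j\<close> is the projection onto column \<open>j\<close>.\<close>

lemma graded_left_submodules_iff:
  assumes "j \<in> Field r"
  shows "N \<in> graded_left_submodules (pair_groupoid (Field r)) (UT r A) (UT_component r A)
      (UT_id A) (j, j) \<longleftrightarrow>
    N \<subseteq> supported (UNIV \<times> {j}) \<and> left_submodule (UT r A) N \<and>
    is_graded (pair_groupoid (Field r)) (UT r A) (UT_component r A) N"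
proof -
  let ?E = "single_entry A \<one> j j"
  have mult: "M \<otimes>\<^bsub>UT r A\<^esub> ?E = (\<lambda>k l. if l = j then M k j else \<zero>)"
    if "M \<in> carrier (UT r A)" for M
    using that by (subst mult_single_entry) (auto simp: fun_eq_iff)
  have "M \<otimes>\<^bsub>UT r A\<^esub> ?E \<in> supported (UNIV \<times> {j})" if "M \<in> carrier (UT r A)" for M
    using UT_mult_closed[OF that single_entry_closed[OF one_closed refl_r[OF assms]]] mult[OF that]
    by (simp add: supported_def)
  moreover have "M = M \<otimes>\<^bsub>UT r A\<^esub> ?E" "M \<in> carrier (UT r A)" if "M \<in> supported (UNIV \<times> {j})" for M
    using that mult[of M] by (auto simp: supported_def fun_eq_iff)
  ultimately have "(\<lambda>M. M \<otimes>\<^bsub>UT r A\<^esub> ?E) ` carrier (UT r A) = supported (UNIV \<times> {j})"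
    by blast
  then show ?thesis by (simp add: graded_left_submodules_def UT_id_def)
qed

text \<open>Left multiplication by \<open>E\<^sub>i\<^sub>i\<close> is the projection onto row \<open>i\<close>.\<close>

lemma graded_right_submodules_iff:
  assumes "i \<in> Field r"
  shows "N \<in> graded_right_submodules (pair_groupoid (Field r)) (UT r A) (UT_component r A)
      (UT_id A) (i, i) \<longleftrightarrow>
    N \<subseteq> supported ({i} \<times> UNIV) \<and> right_submodule (UT r A) N \<and>
    is_graded (pair_groupoid (Field r)) (UT r A) (UT_component r A) N"
proof -
  let ?E = "single_entry A \<one> i i"
  have mult: "?E \<otimes>\<^bsub>UT r A\<^esub> M = (\<lambda>k l. if k = i then M i l else \<zero>)"
    if "M \<in> carrier (UT r A)" for M
    using that by (subst single_entry_mult) (auto simp: fun_eq_iff)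
  have "?E \<otimes>\<^bsub>UT r A\<^esub> M \<in> supported ({i} \<times> UNIV)" if "M \<in> carrier (UT r A)" for M
    using UT_mult_closed[OF single_entry_closed[OF one_closed refl_r[OF assms]] that] mult[OF that]
    by (simp add: supported_def)
  moreover have "M = ?E \<otimes>\<^bsub>UT r A\<^esub> M" "M \<in> carrier (UT r A)" if "M \<in> supported ({i} \<times> UNIV)" for M
    using that mult[of M] by (auto simp: supported_def fun_eq_iff)
  ultimately have "(\<lambda>M. ?E \<otimes>\<^bsub>UT r A\<^esub> M) ` carrier (UT r A) = supported ({i} \<times> UNIV)"
    by blast
  then show ?thesis by (simp add: graded_right_submodules_def UT_id_def)
qed

lemma entries_at_off_support:
  assumes "N \<subseteq> supported P" "(i, j) \<notin> P" "additive_subgroup N (UT r A)"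
  shows "entries_at N i j = {\<zero>}"
proof
  show "entries_at N i j \<subseteq> {\<zero>}"
  proof
    fix a assume "a \<in> entries_at N i j"
    then have "single_entry A a i j \<in> supported P" using assms(1) by (auto simp: entries_at_def)
    then have "single_entry A a i j i j = \<zero>" using assms(2) unfolding supported_def by blast
    then show "a \<in> {\<zero>}" by (simp add: single_entry_def)
  qed
  show "{\<zero>} \<subseteq> entries_at N i j"
    using additive_subgroup.zero_closed[OF additive_subgroup_entries_at[OF assms(3)]] by simp
qed

text \<open>For \<open>i = k\<close> this says that the entries at a position form a left ideal; for \<open>b = 1\<close> it
  says that the ideals grow as one moves up the column.\<close>

lemma entries_at_left_closed:
  assumes "left_submodule (UT r A) N" "b \<in> carrier A" "(i, k) \<in> r" "a \<in> entries_at N k j"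
  shows "b \<otimes> a \<in> entries_at N i j"
proof -
  have a: "a \<in> carrier A" "single_entry A a k j \<in> N" using assms(4) by (auto simp: entries_at_def)
  have "single_entry A b i k \<otimes>\<^bsub>UT r A\<^esub> single_entry A a k j \<in> N"
    using assms(1) a(2) single_entry_closed[OF assms(2,3)] unfolding left_submodule_def by blast
  then show ?thesis
    using single_entry_mult_single_entry[OF assms(2) a(1), of i k k j] assms(2) a(1)
    by (simp add: entries_at_def)
qed

text \<open>For \<open>k = j\<close> this says that the entries at a position form a right ideal; for \<open>b = 1\<close> it
  says that the ideals grow as one moves right along the row.\<close>

lemma entries_at_right_closed:
  assumes "right_submodule (UT r A) N" "b \<in> carrier A" "(k, j) \<in> r" "a \<in> entries_at N i k"
  shows "a \<otimes> b \<in> entries_at N i j"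
proof -
  have a: "a \<in> carrier A" "single_entry A a i k \<in> N" using assms(4) by (auto simp: entries_at_def)
  have "single_entry A a i k \<otimes>\<^bsub>UT r A\<^esub> single_entry A b k j \<in> N"
    using assms(1) a(2) single_entry_closed[OF assms(2,3)] unfolding right_submodule_def by blast
  then show ?thesis
    using single_entry_mult_single_entry[OF a(1) assms(2), of i k k j] assms(2) a(1)
    by (simp add: entries_at_def)
qed

section \<open>The descending chain condition\<close>

text \<open>In column \<open>j\<close> the families of left ideals are indexed by all rows; the rows \<open>i\<close> with
  \<open>(i, j) \<notin> r\<close> contribute the zero ideal.\<close>

lemma left_Gamma0_artinian_UT:
  assumes "Well_order r" "left_artinian A"
  shows "left_Gamma0_artinian (pair_groupoid (Field r)) (UT r A) (UT_component r A) (UT_id A)"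
  unfolding left_Gamma0_artinian_def objects_pair_groupoid
proof (intro ballI, elim imageE, hypsubst)
  fix j assume j: "j \<in> Field r"
  let ?S = "graded_left_submodules (pair_groupoid (Field r)) (UT r A) (UT_component r A)
    (UT_id A) (j, j)"
  have S: "N \<subseteq> supported (UNIV \<times> {j})" "left_submodule (UT r A) N" "additive_subgroup N (UT r A)"
    "is_graded (pair_groupoid (Field r)) (UT r A) (UT_component r A) N" if "N \<in> ?S" for N
    using that graded_left_submodules_iff[OF j, of N] by (auto simp: left_submodule_def)
  show "dcc ?S"
  proof (rule dcc_if_antitone_families[OF assms(1) order_refl assms(2)[unfolded left_artinian_def],
        where \<phi> = "\<lambda>N i. entries_at N i j"])
    fix N i assume N: "N \<in> ?S" and i: "i \<in> Field r"
    show "entries_at N i j \<in> {L. left_submodule A L}"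
      using entries_at_left_closed[OF S(2)[OF N] _ refl_r[OF i]] additive_subgroup_entries_at[OF S(3)[OF N]]
      by (simp add: left_submodule_def)
  next
    fix N i k assume N: "N \<in> ?S" and ik: "(i, k) \<in> r"
    show "entries_at N k j \<subseteq> entries_at N i j"
    proof
      fix a assume a: "a \<in> entries_at N k j"
      then have "a \<in> carrier A" by (simp add: entries_at_def)
      then show "a \<in> entries_at N i j"
        using entries_at_left_closed[OF S(2)[OF N] one_closed ik a] by simp
    qed
  next
    fix N N' assume N: "N \<in> ?S" and N': "N' \<in> ?S"
      and eq: "\<And>i. i \<in> Field r \<Longrightarrow> entries_at N i j = entries_at N' i j"
    show "N = N'"
    proof (rule graded_eqI[OF S(4,3)[OF N] S(4,3)[OF N']])
      fix k l assume "(k, l) \<in> r"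
      then show "entries_at N k l = entries_at N' k l"
        using eq[OF FieldI1] entries_at_off_support[OF S(1)[OF N] _ S(3)[OF N], of k l]
          entries_at_off_support[OF S(1)[OF N'] _ S(3)[OF N'], of k l]
        by (cases "l = j") auto
    qed
  qed (auto simp: entries_at_def)
qed

text \<open>Along a row the ideals grow with respect to \<open>r\<close>, so they decrease with respect to \<open>r\<inverse>\<close>, and it
  is \<open>r\<inverse>\<close> that has to be a well-order.\<close>

lemma right_Gamma0_artinian_UT:
  assumes "Well_order (r\<inverse>)" "right_artinian A"
  shows "right_Gamma0_artinian (pair_groupoid (Field r)) (UT r A) (UT_component r A) (UT_id A)"
  unfolding right_Gamma0_artinian_def objects_pair_groupoid
proof (intro ballI, elim imageE, hypsubst)
  fix i assume i: "i \<in> Field r"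
  let ?S = "graded_right_submodules (pair_groupoid (Field r)) (UT r A) (UT_component r A)
    (UT_id A) (i, i)"
  have S: "N \<subseteq> supported ({i} \<times> UNIV)" "right_submodule (UT r A) N" "additive_subgroup N (UT r A)"
    "is_graded (pair_groupoid (Field r)) (UT r A) (UT_component r A) N" if "N \<in> ?S" for N
    using that graded_right_submodules_iff[OF i, of N] by (auto simp: right_submodule_def)
  show "dcc ?S"
  proof (rule dcc_if_antitone_families[OF assms(1) order_refl assms(2)[unfolded right_artinian_def],
        where \<phi> = "\<lambda>N j. entries_at N i j"])
    fix N j assume N: "N \<in> ?S" and j: "j \<in> Field (r\<inverse>)"
    then have "(j, j) \<in> r" using refl_r by simp
    then show "entries_at N i j \<in> {L. right_submodule A L}"
      using entries_at_right_closed[OF S(2)[OF N]] additive_subgroup_entries_at[OF S(3)[OF N]]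
      by (simp add: right_submodule_def)
  next
    fix N j k assume N: "N \<in> ?S" and jk: "(j, k) \<in> r\<inverse>"
    show "entries_at N i k \<subseteq> entries_at N i j"
    proof
      fix a assume a: "a \<in> entries_at N i k"
      then have "a \<in> carrier A" by (simp add: entries_at_def)
      then show "a \<in> entries_at N i j"
        using entries_at_right_closed[OF S(2)[OF N] one_closed _ a] jk by simp
    qed
  next
    fix N N' assume N: "N \<in> ?S" and N': "N' \<in> ?S"
      and eq: "\<And>j. j \<in> Field (r\<inverse>) \<Longrightarrow> entries_at N i j = entries_at N' i j"
    show "N = N'"
    proof (rule graded_eqI[OF S(4,3)[OF N] S(4,3)[OF N']])
      fix k l assume "(k, l) \<in> r"
      then have "l \<in> Field (r\<inverse>)" by (simp add: FieldI2)
      then show "entries_at N k l = entries_at N' k l"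
        using eq entries_at_off_support[OF S(1)[OF N] _ S(3)[OF N], of k l]
          entries_at_off_support[OF S(1)[OF N'] _ S(3)[OF N'], of k l]
        by (cases "k = i") auto
    qed
  qed (auto simp: entries_at_def)
qed

section \<open>Failure of the ascending chain condition\<close>

lemma left_submodule_supported:
  assumes P: "\<And>i k j. (i, k) \<in> r \<Longrightarrow> (k, j) \<in> P \<Longrightarrow> (i, j) \<in> P"
  shows "left_submodule (UT r A) (supported P)"
  unfolding left_submodule_def
proof (intro conjI additive_subgroup_supported ballI)
  fix B M assume B: "B \<in> carrier (UT r A)" and M: "M \<in> supported P"
  then have MU: "M \<in> carrier (UT r A)" by (simp add: supported_def)
  have "(i, j) \<in> P" if nz: "(B \<otimes>\<^bsub>UT r A\<^esub> M) i j \<noteq> \<zero>" for i j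
  proof -
    obtain k where "B i k \<noteq> \<zero>" "M k j \<noteq> \<zero>"
      using UT_mult_nonzero[OF nz UT_entry[OF B] UT_entry[OF MU]] by blast
    then have "(i, k) \<in> r" "(k, j) \<in> P"
      using B M unfolding supported_def in_UT_iff by blast+
    then show ?thesis by (rule P)
  qed
  then show "B \<otimes>\<^bsub>UT r A\<^esub> M \<in> supported P"
    using UT_mult_closed[OF B MU] unfolding supported_def by blast
qed

lemma right_submodule_supported:
  assumes P: "\<And>i k j. (i, k) \<in> P \<Longrightarrow> (k, j) \<in> r \<Longrightarrow> (i, j) \<in> P"
  shows "right_submodule (UT r A) (supported P)"
  unfolding right_submodule_def
proof (intro conjI additive_subgroup_supported ballI)
  fix B M assume B: "B \<in> carrier (UT r A)" and M: "M \<in> supported P"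
  then have MU: "M \<in> carrier (UT r A)" by (simp add: supported_def)
  have "(i, j) \<in> P" if nz: "(M \<otimes>\<^bsub>UT r A\<^esub> B) i j \<noteq> \<zero>" for i j
  proof -
    obtain k where "M i k \<noteq> \<zero>" "B k j \<noteq> \<zero>"
      using UT_mult_nonzero[OF nz UT_entry[OF MU] UT_entry[OF B]] by blast
    then have "(i, k) \<in> P" "(k, j) \<in> r"
      using B M unfolding supported_def in_UT_iff by blast+
    then show ?thesis by (rule P)
  qed
  then show "M \<otimes>\<^bsub>UT r A\<^esub> B \<in> supported P"
    using UT_mult_closed[OF MU B] unfolding supported_def by blast
qed

text \<open>The matrix unit at a new position of \<open>P (Suc n)\<close> separates two consecutive members of the
  chain.\<close>

lemma not_acc_if_supported_chain:
  assumes one: "\<one> \<noteq> \<zero>"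
    and S: "\<And>n :: nat. supported (P n) \<in> \<S>"
    and mono: "\<And>m n. m \<le> n \<Longrightarrow> P m \<subseteq> P n"
    and new: "\<And>n. \<exists>g\<in>r. g \<in> P (Suc n) \<and> g \<notin> P n"
  shows "\<not> acc \<S>"
proof
  assume "acc \<S>"
  moreover have "mono (\<lambda>n. supported (P n))"
  proof (rule monoI)
    fix m n :: nat assume "m \<le> n"
    then show "supported (P m) \<subseteq> supported (P n)"
      using mono[of m n] unfolding supported_def by blast
  qed
  ultimately obtain m where m: "\<forall>n\<ge>m. supported (P n) = supported (P m)"
    using S unfolding acc_def by (metis (no_types, lifting) image_subsetI)
  obtain i j where ij: "(i, j) \<in> r" "(i, j) \<in> P (Suc m)" "(i, j) \<notin> P m"
    using new[of m] by (metis surj_pair)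
  have "single_entry A \<one> i j \<in> supported (P (Suc m))"
    using single_entry_closed[OF one_closed ij(1)] ij(2)
    by (auto simp: supported_def single_entry_def)
  then have "single_entry A \<one> i j \<in> supported (P m)"
    using m[rule_format, of "Suc m"] by simp
  then have "single_entry A \<one> i j i j = \<zero>" using ij(3) unfolding supported_def by blast
  then show False using one by (simp add: single_entry_def)
qed

lemma not_left_Gamma0_noetherian_UT:
  fixes s :: "nat \<Rightarrow> 'i"
  assumes one: "\<one> \<noteq> \<zero>"
    and s: "\<And>m n. (s m, s n) \<in> r \<longleftrightarrow> m \<le> n" and w: "\<And>n. (s n, w) \<in> r"
  shows "\<not> left_Gamma0_noetherian (pair_groupoid (Field r)) (UT r A) (UT_component r A) (UT_id A)"
proof
  assume noeth: "left_Gamma0_noetherian (pair_groupoid (Field r)) (UT r A) (UT_component r A) (UT_id A)"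
  have wF: "w \<in> Field r" using w[of 0] by (rule FieldI2)
  let ?P = "\<lambda>n. {i. (i, s n) \<in> r} \<times> {w}"
  have "\<not> acc (graded_left_submodules (pair_groupoid (Field r)) (UT r A) (UT_component r A)
      (UT_id A) (w, w))"
  proof (rule not_acc_if_supported_chain[OF one, where P = ?P])
    fix n
    have "left_submodule (UT r A) (supported (?P n))"
      by (rule left_submodule_supported) (auto intro: trans_r)
    moreover have "supported (?P n) \<subseteq> supported (UNIV \<times> {w})" by (auto simp: supported_def)
    ultimately show "supported (?P n) \<in> graded_left_submodules (pair_groupoid (Field r)) (UT r A)
        (UT_component r A) (UT_id A) (w, w)"
      using graded_left_submodules_iff[OF wF] is_graded_supported by simp
    show "\<exists>g\<in>r. g \<in> ?P (Suc n) \<and> g \<notin> ?P n"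
      using s[of "Suc n" n] s[of "Suc n" "Suc n"] w by (intro bexI[of _ "(s (Suc n), w)"]) auto
  next
    fix m n :: nat assume "m \<le> n"
    then have "(s m, s n) \<in> r" using s by simp
    then show "?P m \<subseteq> ?P n" using trans_r by blast
  qed
  then show False using noeth wF unfolding left_Gamma0_noetherian_def objects_pair_groupoid by blast
qed

lemma not_right_Gamma0_noetherian_UT:
  fixes s :: "nat \<Rightarrow> 'i"
  assumes one: "\<one> \<noteq> \<zero>"
    and s: "\<And>m n. (s n, s m) \<in> r \<longleftrightarrow> m \<le> n" and w: "\<And>n. (w, s n) \<in> r"
  shows "\<not> right_Gamma0_noetherian (pair_groupoid (Field r)) (UT r A) (UT_component r A) (UT_id A)"
proof
  assume noeth: "right_Gamma0_noetherian (pair_groupoid (Field r)) (UT r A) (UT_component r A) (UT_id A)"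
  have wF: "w \<in> Field r" using w[of 0] by (rule FieldI1)
  let ?P = "\<lambda>n. {w} \<times> {j. (s n, j) \<in> r}"
  have "\<not> acc (graded_right_submodules (pair_groupoid (Field r)) (UT r A) (UT_component r A)
      (UT_id A) (w, w))"
  proof (rule not_acc_if_supported_chain[OF one, where P = ?P])
    fix n
    have "right_submodule (UT r A) (supported (?P n))"
      by (rule right_submodule_supported) (auto intro: trans_r)
    moreover have "supported (?P n) \<subseteq> supported ({w} \<times> UNIV)" by (auto simp: supported_def)
    ultimately show "supported (?P n) \<in> graded_right_submodules (pair_groupoid (Field r)) (UT r A)
        (UT_component r A) (UT_id A) (w, w)"
      using graded_right_submodules_iff[OF wF] is_graded_supported by simp
    show "\<exists>g\<in>r. g \<in> ?P (Suc n) \<and> g \<notin> ?P n"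
      using s[of n "Suc n"] s[of "Suc n" "Suc n"] w by (intro bexI[of _ "(w, s (Suc n))"]) auto
  next
    fix m n :: nat assume "m \<le> n"
    then have "(s n, s m) \<in> r" using s by simp
    then show "?P m \<subseteq> ?P n" using trans_r by blast
  qed
  then show False using noeth wF unfolding right_Gamma0_noetherian_def objects_pair_groupoid by blast
qed

end

section \<open>Well-orders longer than \<open>\<omega>\<close>\<close>

text \<open>The ordinal \<open>\<omega>\<close> is isomorphic to a proper initial segment of any longer well-order;
  \<open>w\<close> is the point that cuts it off.\<close>

lemma omega_chain_below:
  fixes r :: "'i rel"
  assumes "natLeq <o r"
  obtains s :: "nat \<Rightarrow> 'i" and w
  where "\<And>m n. (s m, s n) \<in> r \<longleftrightarrow> m \<le> n" "\<And>n. (s n, w) \<in> r"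
proof -
  have wo: "Well_order natLeq" "Well_order r"
    using assms natLeq_Well_order by (auto simp: ordLess_def)
  then obtain w where "natLeq =o Restr r (underS r w)"
    using assms ordLess_iff_ordIso_Restr by blast
  then obtain s where s: "BNF_Wellorder_Embedding.iso natLeq (Restr r (underS r w)) s" by (auto simp: ordIso_def)
  have F: "s n \<in> underS r w" for n
  proof -
    have "s n \<in> Field (Restr r (underS r w))"
      using s by (auto simp: iso_iff2 Field_natLeq bij_betw_def)
    then show ?thesis by (auto simp: Field_def)
  qed
  show ?thesis
  proof
    fix m n
    have "m \<le> n \<longleftrightarrow> (m, n) \<in> natLeq" by (simp add: natLeq_def)
    also have "\<dots> \<longleftrightarrow> (s m, s n) \<in> Restr r (underS r w)"
      using s unfolding iso_iff2 Field_natLeq by blast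
    finally show "(s m, s n) \<in> r \<longleftrightarrow> m \<le> n" using F by blast
    show "(s n, w) \<in> r" using F by (auto simp: underS_def)
  qed
qed

theorem corollary3p59:
  fixes r :: "'i rel" and A :: "('a, 'm) ring_scheme"
  assumes "natLeq <o r"
    and "ring A" and "\<one>\<^bsub>A\<^esub> \<noteq> \<zero>\<^bsub>A\<^esub>"
  shows "(left_artinian A \<longrightarrow>
            groupoid_graded_ring (pair_groupoid (Field r)) (UT r A) (UT_component r A) (UT_id A) \<and>
            left_Gamma0_artinian (pair_groupoid (Field r)) (UT r A) (UT_component r A) (UT_id A) \<and>
            \<not> left_Gamma0_noetherian (pair_groupoid (Field r)) (UT r A) (UT_component r A) (UT_id A))
       \<and> (right_artinian A \<longrightarrow>
            groupoid_graded_ring (pair_groupoid (Field r)) (UT (r\<inverse>) A) (UT_component (r\<inverse>) A) (UT_id A) \<and>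
            right_Gamma0_artinian (pair_groupoid (Field r)) (UT (r\<inverse>) A) (UT_component (r\<inverse>) A) (UT_id A) \<and>
            \<not> right_Gamma0_noetherian (pair_groupoid (Field r)) (UT (r\<inverse>) A) (UT_component (r\<inverse>) A) (UT_id A))"
proof -
  have wo: "Well_order r" using assms(1) by (auto simp: ordLess_def)
  have r: "(i, i) \<in> r" if "i \<in> Field r" for i
    using wo that by (auto simp: order_on_defs refl_on_def)
  have t: "(i, k) \<in> r" if "(i, j) \<in> r" "(j, k) \<in> r" for i j k
    using wo that by (auto simp: order_on_defs elim: transE)
  interpret U: upper_triangular A r
    using assms(2) r t by (simp add: upper_triangular_def upper_triangular_axioms_def)
  interpret V: upper_triangular A "r\<inverse>"
    using assms(2) r t by (auto simp: upper_triangular_def upper_triangular_axioms_def)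
  obtain s :: "nat \<Rightarrow> 'i" and w
    where s: "\<And>m n. (s m, s n) \<in> r \<longleftrightarrow> m \<le> n" and w: "\<And>n. (s n, w) \<in> r"
    using omega_chain_below[OF assms(1)] by blast
  have "\<not> right_Gamma0_noetherian (pair_groupoid (Field (r\<inverse>))) (UT (r\<inverse>) A)
      (UT_component (r\<inverse>) A) (UT_id A)"
    using assms(3) s w by (intro V.not_right_Gamma0_noetherian_UT[of s w]) simp_all
  then show ?thesis
    using U.groupoid_graded_ring_UT U.left_Gamma0_artinian_UT[OF wo]
      U.not_left_Gamma0_noetherian_UT[OF assms(3) s w]
      V.groupoid_graded_ring_UT V.right_Gamma0_artinian_UT wo
    by simp
qed

end
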